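(* For every integer $n\ge 1$, $$\mathrm{pf}_n(132,213,321)=\mathrm{pf}_n(132,312,321)=\mathrm{pf}_n(213,231,321)=\binom{2n-1}{n}.$$
   Context: A Dyck path of semilength $n$ is a lattice path from $(0,0)$ to $(n,n)$ consisting of $n$ north steps $N=(0,1)$ and $n$ east steps $E=(1,0)$ that never goes below the line $y=x$. A parking function of size $n$ is a Dyck path of semilength $n$ whose $n$ north steps are labeled bijectively by $\{1,\dots,n\}$ so that whenever two north steps are consecutive in the path (one immediately following the other), the label of the later one is larger. For a parking function $p$ of size $n$, $\phi(p)$ is the permutation of $\{1,\dots,n\}$ (in one-line notation) obtained by reading the labels of the north steps in the order they occur along the path. A permutation $\pi$ of $\{1,\dots,n\}$ contains a permutation $\rho$ of $\{1,\dots,m\}$ if there are indices $1\le i_1<\cdots<i_m\le n$ such that $\pi_{i_a}\le\pi_{i_b}$ if and only if $\rho_a\le\rho_b$; otherwise $\pi$ avoids $\rho$. For permutations $\rho_1,\dots,\rho_r$, $\mathrm{pf}_n(\rho_1,\dots,\rho_r)$ denotes the number of parking functions $p$ of size $n$ such that $\phi(p)$ avoids each of $\rho_1,\dots,\rho_r$. *)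

theory Defs
  imports "HOL-Combinatorics.Multiset_Permutations"
begin

datatype step = N | E

text \<open>
  A path starts at \<open>(0,0)\<close>; after its first \<open>k\<close> steps it is at the lattice point
  \<open>point_after w k\<close>. As \<open>E\<close> and \<open>N\<close> steps are monotone and the line has slope 1,
  a path never goes below \<open>y = x\<close> iff all these lattice points satisfy \<open>x \<le> y\<close>.
\<close>

definition point_after :: "step list \<Rightarrow> nat \<Rightarrow> nat \<times> nat" where
  "point_after w k = (count_list (take k w) E, count_list (take k w) N)"

definition dyck_path :: "nat \<Rightarrow> step list \<Rightarrow> bool" where
  "dyck_path n w \<longleftrightarrow>
     count_list w N = n \<and> count_list w E = n \<and>
     (\<forall>k \<le> length w. fst (point_after w k) \<le> snd (point_after w k))"

datatype labelled_step = North nat | East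

fun underlying_step :: "labelled_step \<Rightarrow> step" where
  "underlying_step (North a) = N"
| "underlying_step East = E"

fun north_labels :: "labelled_step list \<Rightarrow> nat list" where
  "north_labels [] = []"
| "north_labels (North a # p) = a # north_labels p"
| "north_labels (East # p) = north_labels p"

text \<open>
  Permutations of \<open>{1..n}\<close> in one-line notation are the elements of
  \<open>permutations_of_set {1..n}\<close>, the duplicate-free lists with element set \<open>{1..n}\<close>.
\<close>

definition parking_function :: "nat \<Rightarrow> labelled_step list \<Rightarrow> bool" where
  "parking_function n p \<longleftrightarrow>
     dyck_path n (map underlying_step p) \<and>
     north_labels p \<in> permutations_of_set {1..n} \<and>
     (\<forall>i a b. Suc i < length p \<and> p ! i = North a \<and> p ! Suc i = North b \<longrightarrow> a < b)"

definition \<phi> :: "labelled_step list \<Rightarrow> nat list" where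
  "\<phi> p = north_labels p"

text \<open>Positions in one-line notation are counted from 0 here.\<close>

definition perm_contains :: "nat list \<Rightarrow> nat list \<Rightarrow> bool" where
  "perm_contains \<pi> \<rho> \<longleftrightarrow>
     (\<exists>i :: nat \<Rightarrow> nat.
        strict_mono_on {..<length \<rho>} i \<and>
        (\<forall>a < length \<rho>. i a < length \<pi>) \<and>
        (\<forall>a < length \<rho>. \<forall>b < length \<rho>. \<pi> ! i a \<le> \<pi> ! i b \<longleftrightarrow> \<rho> ! a \<le> \<rho> ! b))"

definition perm_avoids :: "nat list \<Rightarrow> nat list \<Rightarrow> bool" where
  "perm_avoids \<pi> \<rho> \<longleftrightarrow> \<not> perm_contains \<pi> \<rho>"

definition pf :: "nat \<Rightarrow> nat list set \<Rightarrow> nat" where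
  "pf n R = card {p. parking_function n p \<and> (\<forall>\<rho> \<in> R. perm_avoids (\<phi> p) \<rho>)}"

end

theory Submission
  imports Defs
begin

text \<open>
  A parking function with labels \<open>\<pi>\<close> is a Dyck path in which the north steps around each descent
  of \<open>\<pi>\<close> are separated by an east step. Each of the three classes consists of the identity and,
  for each \<open>0 < d < n\<close>, one permutation whose only descent is at \<open>d\<close>. As the last north step of a Dyck
  path is always followed by an east step, the parking functions correspond to the Dyck paths of
  semilength \<open>n\<close> with a marked peak. Deleting the peak leaves a Dyck path of semilength \<open>n - 1\<close>
  with one of its \<open>2n - 1\<close> lattice points marked, so their number is \<open>2n - 1\<close> times a Catalan number.
\<close>

section \<open>Ballot paths and their peaks\<close>

text \<open>The end point \<open>(b, a)\<close> is left free instead of being placed on the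
  diagonal, because the inductions strip the last step of a path.\<close>

definition ballot_paths :: "nat \<Rightarrow> nat \<Rightarrow> step list set" where
  "ballot_paths a b = {w. count_list w N = a \<and> count_list w E = b \<and>
     (\<forall>k \<le> length w. count_list (take k w) E \<le> count_list (take k w) N)}"

text \<open>An occurrence is recorded by the position of its first step;
  \<open>factors N E w\<close> collects the peaks and \<open>factors N N w\<close> the double
  rises.\<close>

definition factors :: "step \<Rightarrow> step \<Rightarrow> step list \<Rightarrow> nat set" where
  "factors s t w = {i. Suc i < length w \<and> w ! i = s \<and> w ! Suc i = t}"

lemma dyck_path_iff_ballot: "dyck_path n w \<longleftrightarrow> w \<in> ballot_paths n n"
  by (simp add: dyck_path_def ballot_paths_def point_after_def)

lemma length_eq_count_steps: "length w = count_list w N + count_list w E"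
proof (induction w)
  case (Cons s w)
  then show ?case by (cases s) auto
qed simp

lemma finite_ballot_paths: "finite (ballot_paths a b)"
proof (rule finite_subset)
  have "UNIV = {N, E}"
    using step.exhaust by auto
  then have "finite (UNIV :: step set)"
    by (metis finite.emptyI finite.insertI)
  then show "finite {w :: step list. set w \<subseteq> UNIV \<and> length w = a + b}"
    by (rule finite_lists_length_eq)
  show "ballot_paths a b \<subseteq> {w. set w \<subseteq> UNIV \<and> length w = a + b}"
    by (auto simp: ballot_paths_def length_eq_count_steps)
qed

text \<open>Among the prefixes of \<open>v @ [s]\<close> only the whole word is new, and for it the
  ballot condition reads \<open>b \<le> a\<close>.\<close>

lemma ballot_paths_snoc:
  "v @ [s] \<in> ballot_paths a b \<longleftrightarrow>
     b \<le> a \<and> (case s of N \<Rightarrow> a > 0 \<and> v \<in> ballot_paths (a - 1) b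
                     | E \<Rightarrow> b > 0 \<and> v \<in> ballot_paths a (b - 1))"
proof -
  have "(\<forall>k \<le> length (v @ [s]). count_list (take k (v @ [s])) E \<le> count_list (take k (v @ [s])) N)
    \<longleftrightarrow> (\<forall>k \<le> length v. count_list (take k v) E \<le> count_list (take k v) N) \<and>
        count_list (v @ [s]) E \<le> count_list (v @ [s]) N"
    by (auto simp: le_Suc_eq)
  then show ?thesis
    by (cases s) (auto simp: ballot_paths_def)
qed

lemma Nil_in_ballot_paths: "[] \<in> ballot_paths a b \<longleftrightarrow> a = 0 \<and> b = 0"
  by (auto simp: ballot_paths_def)

lemma ballot_paths_empty: "a < b \<Longrightarrow> ballot_paths a b = {}"
  by (force simp: ballot_paths_def)

lemma ballot_paths_zero_right: "ballot_paths a 0 = {replicate a N}"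
proof (induction a)
  case 0
  show ?case
    by (auto simp: Nil_in_ballot_paths, auto simp: ballot_paths_def, metis length_eq_count_steps length_0_conv add_0)
next
  case (Suc a)
  have "w \<in> ballot_paths (Suc a) 0 \<longleftrightarrow> w = replicate (Suc a) N" for w
  proof (cases w rule: rev_cases)
    case Nil
    then show ?thesis by (auto simp: Nil_in_ballot_paths)
  next
    case (snoc v s)
    have "replicate (Suc a) N = replicate a N @ [N]"
      by (simp add: replicate_append_same)
    then show ?thesis
      using Suc snoc by (cases s) (auto simp: ballot_paths_snoc simp del: replicate.simps)
  qed
  then show ?case by blast
qed

text \<open>Case split on the last step. The hypothesis keeps the end point on or above the
  diagonal; for \<open>b = a\<close> the part ending in \<open>N\<close> is empty.\<close>

lemma ballot_paths_Suc:
  assumes "b \<le> a"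
  shows "ballot_paths (Suc a) (Suc b) =
    (\<lambda>v. v @ [N]) ` ballot_paths a (Suc b) \<union> (\<lambda>v. v @ [E]) ` ballot_paths (Suc a) b"
proof -
  have "w \<in> ballot_paths (Suc a) (Suc b) \<longleftrightarrow>
    w \<in> (\<lambda>v. v @ [N]) ` ballot_paths a (Suc b) \<union> (\<lambda>v. v @ [E]) ` ballot_paths (Suc a) b" for w
  proof (cases w rule: rev_cases)
    case Nil
    then show ?thesis by (auto simp: Nil_in_ballot_paths)
  next
    case (snoc v s)
    then show ?thesis
      using assms by (cases s) (auto simp: ballot_paths_snoc)
  qed
  then show ?thesis by blast
qed

lemma sum_ballot_paths_Suc:
  fixes g :: "step list \<Rightarrow> nat"
  assumes "b \<le> a"
  shows "sum g (ballot_paths (Suc a) (Suc b)) =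
    (\<Sum>v\<in>ballot_paths a (Suc b). g (v @ [N])) + (\<Sum>v\<in>ballot_paths (Suc a) b. g (v @ [E]))"
proof -
  have "sum g (ballot_paths (Suc a) (Suc b)) =
    sum g ((\<lambda>v. v @ [N]) ` ballot_paths a (Suc b)) + sum g ((\<lambda>v. v @ [E]) ` ballot_paths (Suc a) b)"
    unfolding ballot_paths_Suc[OF assms]
    by (rule sum.union_disjoint) (auto simp: finite_ballot_paths)
  then show ?thesis
    by (simp add: sum.reindex inj_on_def)
qed

lemma card_ballot_paths_Suc:
  "b \<le> a \<Longrightarrow> card (ballot_paths (Suc a) (Suc b)) =
     card (ballot_paths a (Suc b)) + card (ballot_paths (Suc a) b)"
  using sum_ballot_paths_Suc[of b a "\<lambda>_. 1"] by simp

text \<open>These are the ballot numbers \<open>C(a+b+1, b+1) - C(a+b+1, b)\<close>, written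
  additively to avoid truncated subtraction. The recursion on the last step matches Pascal's rule.
  The range includes \<open>b = a\<close>, where the end point lies just below the diagonal and the
  two binomials agree; this is the boundary value of the induction.\<close>

lemma card_ballot_paths:
  "b \<le> a \<Longrightarrow> card (ballot_paths a (Suc b)) + ((a + Suc b) choose b) = (a + Suc b) choose Suc b"
proof (induction "a + b" arbitrary: a b rule: less_induct)
  case less
  show ?case
  proof (cases "b = a")
    case True
    have "(a + Suc a) choose a = (a + Suc a) choose Suc a"
      using binomial_symmetric[of a "a + Suc a"] by simp
    then show ?thesis
      using True by (simp add: ballot_paths_empty)
  next
    case False
    then obtain c where c: "a = Suc c" "b \<le> c"
      using less.prems by (cases a) auto
    have top: "card (ballot_paths c (Suc b)) + ((c + Suc b) choose b) = (c + Suc b) choose Suc b"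
      using less.hyps[of c b] c by simp
    have rec: "card (ballot_paths a (Suc b)) = card (ballot_paths c (Suc b)) + card (ballot_paths a b)"
      using card_ballot_paths_Suc c by simp
    show ?thesis
    proof (cases b)
      case 0
      then show ?thesis
        using top rec c by (simp add: ballot_paths_zero_right)
    next
      case (Suc d)
      have "card (ballot_paths a (Suc d)) + ((a + Suc d) choose d) = (a + Suc d) choose Suc d"
        using less.hyps[of a d] less.prems Suc by simp
      then show ?thesis
        using top rec Suc c by simp
    qed
  qed
qed

section \<open>The total number of peaks over all ballot paths\<close>

lemma factors_snoc:
  "factors s t (v @ [u]) = factors s t v \<union> (if v \<noteq> [] \<and> last v = s \<and> u = t then {length v - 1} else {})"
proof (cases v rule: rev_cases)
  case (snoc v' x)
  then show ?thesis
    by (auto simp: factors_def nth_append less_Suc_eq)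
qed (simp add: factors_def)

lemma finite_factors: "finite (factors s t w)"
  by (rule finite_subset[of _ "{..<length w}"]) (auto simp: factors_def)

lemma card_factors_snoc:
  "card (factors s t (v @ [u])) = card (factors s t v) + of_bool (v \<noteq> [] \<and> last v = s \<and> u = t)"
proof -
  have "length v - 1 \<notin> factors s t v"
    by (auto simp: factors_def)
  then show ?thesis
    by (simp add: factors_snoc finite_factors)
qed

text \<open>Erasing the final \<open>N\<close> is a bijection onto \<open>ballot_paths a b\<close>.
  The paths counted here are those on which an appended \<open>E\<close> creates a peak.\<close>

lemma card_ballot_paths_last_N:
  assumes "b \<le> a"
  shows "card {v \<in> ballot_paths (Suc a) b. v \<noteq> [] \<and> last v = N} = card (ballot_paths a b)"
proof -
  have "v \<in> {v \<in> ballot_paths (Suc a) b. v \<noteq> [] \<and> last v = N} \<longleftrightarrow>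
      v \<in> (\<lambda>v. v @ [N]) ` ballot_paths a b" for v
    by (cases v rule: rev_cases) (use assms in \<open>auto simp: ballot_paths_snoc\<close>)
  then have "{v \<in> ballot_paths (Suc a) b. v \<noteq> [] \<and> last v = N} = (\<lambda>v. v @ [N]) ` ballot_paths a b"
    by blast
  then show ?thesis
    by (simp add: card_image inj_on_def)
qed

text \<open>Deleting a marked peak leaves a path with \<open>a + b\<close> steps and one of its
  \<open>a + b + 1\<close> lattice points marked. The proof replaces this bijection by an induction
  on the last step.\<close>

lemma sum_peaks_ballot_paths:
  "b \<le> a \<Longrightarrow> (\<Sum>w\<in>ballot_paths (Suc a) (Suc b). card (factors N E w)) =
     (a + b + 1) * card (ballot_paths a b)"
proof (induction "a + b" arbitrary: a b rule: less_induct)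
  case less
  have "(\<Sum>v\<in>ballot_paths (Suc a) b. of_bool (v \<noteq> [] \<and> last v = N)) = card (ballot_paths a b)"
    using card_ballot_paths_last_N[OF less.prems]
    by (simp add: finite_ballot_paths Int_def sum.If_cases of_bool_def)
  \<comment> \<open>An appended \<open>N\<close> completes no peak, while an appended
    \<open>E\<close> completes one exactly after an \<open>N\<close>; this gives the third
    summand.\<close>
  then have rec: "(\<Sum>w\<in>ballot_paths (Suc a) (Suc b). card (factors N E w)) =
      (\<Sum>v\<in>ballot_paths a (Suc b). card (factors N E v)) +
      (\<Sum>v\<in>ballot_paths (Suc a) b. card (factors N E v)) + card (ballot_paths a b)"
    using less.prems by (simp add: sum_ballot_paths_Suc card_factors_snoc sum.distrib)
  \<comment> \<open>For \<open>b = 0\<close> the only path consists of north steps and has no peak;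
    otherwise the induction hypothesis has the factor \<open>a + d + 1 = a + b\<close>.\<close>
  have right: "(\<Sum>v\<in>ballot_paths (Suc a) b. card (factors N E v)) =
      (case b of 0 \<Rightarrow> 0 | Suc d \<Rightarrow> (a + b) * card (ballot_paths a d))"
  proof (cases b)
    case 0
    then show ?thesis
      by (simp add: ballot_paths_zero_right factors_def)
  next
    case (Suc d)
    then show ?thesis
      using less.hyps[of a d] less.prems by simp
  qed
  show ?case
  proof (cases "b = a")
    \<comment> \<open>On the diagonal a nonempty path must end in \<open>E\<close>.\<close>
    case True
    then have "card (ballot_paths a b) = (case b of 0 \<Rightarrow> 1 | Suc d \<Rightarrow> card (ballot_paths a d))"
      by (cases b) (auto simp: ballot_paths_zero_right card_ballot_paths_Suc ballot_paths_empty)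
    then show ?thesis
      using rec right True by (cases a) (simp_all add: ballot_paths_empty)
  next
    case False
    then obtain c where c: "a = Suc c" "b \<le> c"
      using less.prems by (cases a) auto
    have top: "(\<Sum>v\<in>ballot_paths a (Suc b). card (factors N E v)) = (c + b + 1) * card (ballot_paths c b)"
      using less.hyps[of c b] c by simp
    \<comment> \<open>With this recursion the first two sums of \<open>rec\<close> combine to
      \<open>a + b\<close> times the cardinality, and the third adds it once more.\<close>
    have "card (ballot_paths a b) =
        card (ballot_paths c b) + (case b of 0 \<Rightarrow> 0 | Suc d \<Rightarrow> card (ballot_paths a d))"
      using c by (cases b) (simp_all add: ballot_paths_zero_right card_ballot_paths_Suc)
    then show ?thesis
      using rec right top c by (cases b) (simp_all add: algebra_simps)
  qed
qed

lemma sum_peaks_dyck: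
  assumes "n \<ge> 1"
  shows "(\<Sum>w\<in>ballot_paths n n. card (factors N E w)) = (2 * n - 1) choose n"
proof -
  obtain m where m: "n = Suc m"
    using assms by (cases n) auto
  \<comment> \<open>The number of Dyck paths of semilength \<open>m\<close> is the Catalan
    number.\<close>
  have catalan: "Suc m * card (ballot_paths m m) = (2 * m) choose m"
  proof (cases m)
    case 0
    then show ?thesis by (simp add: ballot_paths_zero_right)
  next
    case (Suc d)
    have "card (ballot_paths m m) + ((2 * m) choose d) = (2 * m) choose m"
      using card_ballot_paths[of d m] Suc by (simp add: mult_2)
    \<comment> \<open>Both sides equal \<open>2 * m\<close> times
      \<open>(2 * m - 1) choose d\<close>, since \<open>2 * m - d = Suc m\<close>.\<close>
    moreover have "Suc m * ((2 * m) choose d) = m * ((2 * m) choose m)"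
      using binomial_absorb_comp[of "2 * m" d] binomial_absorption[of d "2 * m"] Suc
      by (simp add: algebra_simps)
    ultimately show ?thesis
      by (smt (verit) add_mult_distrib2 add_right_cancel mult_Suc)
  qed
  have "Suc m * (Suc (2 * m) choose Suc m) = Suc (2 * m) * ((2 * m) choose m)"
    by (rule Suc_times_binomial)
  also have "\<dots> = Suc m * (Suc (2 * m) * card (ballot_paths m m))"
    using catalan by (metis mult.left_commute)
  finally have "Suc (2 * m) * card (ballot_paths m m) = Suc (2 * m) choose Suc m"
    by (metis mult_cancel1 nat.distinct(1))
  then show ?thesis
    using sum_peaks_ballot_paths[of m m] m by (simp add: mult_2)
qed

section \<open>Parking functions with prescribed labels\<close>

text \<open>A descent is indexed by the position, counted from 0, of its lower entry, hence by the
  number of entries before the drop. This makes it comparable with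
  \<open>north_rank\<close>.\<close>

definition descents :: "nat list \<Rightarrow> nat set" where
  "descents \<pi> = {i. 0 < i \<and> i < length \<pi> \<and> \<pi> ! i < \<pi> ! (i - 1)}"

text \<open>For a north step at position \<open>i\<close> this is its rank counted from 1, so it is
  also the index, counted from 0, of the label after its own.\<close>

definition north_rank :: "step list \<Rightarrow> nat \<Rightarrow> nat" where
  "north_rank w i = count_list (take (Suc i) w) N"

text \<open>Inverse of separating a labelled path into steps and labels. It is meant for label lists
  with one entry per \<open>N\<close>, as \<open>hd []\<close> is unspecified.\<close>

fun attach_labels :: "step list \<Rightarrow> nat list \<Rightarrow> labelled_step list" where
  "attach_labels [] l = []"
| "attach_labels (N # w) l = North (hd l) # attach_labels w (tl l)"
| "attach_labels (E # w) l = East # attach_labels w l"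

lemma underlying_attach_labels: "map underlying_step (attach_labels w l) = w"
  by (induction w l rule: attach_labels.induct) auto

lemma north_labels_attach_labels:
  "count_list w N = length l \<Longrightarrow> north_labels (attach_labels w l) = l"
  by (induction w l rule: attach_labels.induct) (auto simp: Suc_length_conv)

lemma attach_labels_underlying: "attach_labels (map underlying_step p) (north_labels p) = p"
  by (induction p rule: north_labels.induct) auto

lemma count_N_underlying: "count_list (map underlying_step p) N = length (north_labels p)"
  by (induction p rule: north_labels.induct) auto

lemma north_labels_append: "north_labels (p @ q) = north_labels p @ north_labels q"
  by (induction p rule: north_labels.induct) auto

lemma underlying_step_eq_N: "underlying_step x = N \<longleftrightarrow> (\<exists>a. x = North a)"
  by (cases x) auto

lemma north_labels_nth:
  assumes "i < length p" "p ! i = North a"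
  defines "r \<equiv> length (north_labels (take i p))"
  shows "north_rank (map underlying_step p) i = Suc r"
    and "r < length (north_labels p)"
    and "north_labels p ! r = a"
proof -
  have p: "p = take i p @ North a # drop (Suc i) p"
    using assms id_take_nth_drop by metis
  have "north_labels p = north_labels (take i p) @ a # north_labels (drop (Suc i) p)"
    by (subst p) (simp add: north_labels_append)
  then show "r < length (north_labels p)" "north_labels p ! r = a"
    by (simp_all add: r_def)
  show "north_rank (map underlying_step p) i = Suc r"
    using assms(1,2)
    by (simp add: north_rank_def r_def count_N_underlying take_Suc_conv_app_nth take_map
        flip: map_append) (simp add: take_map count_N_underlying north_labels_append)
qed

text \<open>Two adjacent north steps carry neighbouring entries of the label word, and the rank of
  the first step is the index of the second entry. Distinctness turns the absence of a descent into
  a strict rise.\<close>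

lemma labels_increasing_iff_descents:
  assumes "distinct (north_labels p)"
  shows "(\<forall>i a b. Suc i < length p \<and> p ! i = North a \<and> p ! Suc i = North b \<longrightarrow> a < b) \<longleftrightarrow>
    north_rank (map underlying_step p) ` factors N N (map underlying_step p) \<inter>
      descents (north_labels p) = {}"
proof -
  let ?w = "map underlying_step p" and ?l = "north_labels p"
  have "a < b \<longleftrightarrow> north_rank ?w i \<notin> descents ?l"
    if i: "Suc i < length p" "p ! i = North a" "p ! Suc i = North b" for i a b
  proof -
    define r where "r = length (north_labels (take i p))"
    have r: "north_rank ?w i = Suc r" "?l ! r = a" "r < length ?l"
      using north_labels_nth[of i p a] i by (simp_all add: r_def)
    have "length (north_labels (take (Suc i) p)) = Suc r"
      using i by (simp add: r_def take_Suc_conv_app_nth north_labels_append)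
    then have r': "?l ! Suc r = b" "Suc r < length ?l"
      using north_labels_nth(2,3)[of "Suc i" p b] i by simp_all
    have "a \<noteq> b"
      using assms r r' by (metis n_not_Suc_n nth_eq_iff_index_eq)
    then show ?thesis
      using r r' by (auto simp: descents_def)
  qed
  moreover have "i \<in> factors N N ?w \<longleftrightarrow>
      Suc i < length p \<and> (\<exists>a b. p ! i = North a \<and> p ! Suc i = North b)" for i
    by (auto simp: factors_def underlying_step_eq_N)
  ultimately show ?thesis
    by (auto simp: disjoint_iff image_iff) blast+
qed

text \<open>Forgetting the labels and attaching \<open>\<pi>\<close> are mutually inverse, and the
  label condition only forbids double rises at the descents of \<open>\<pi>\<close>.\<close>

lemma card_parking_functions_with_labels:
  assumes \<pi>: "\<pi> \<in> permutations_of_set {1..n}"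
  shows "card {p. parking_function n p \<and> \<phi> p = \<pi>} =
    card {w \<in> ballot_paths n n. north_rank w ` factors N N w \<inter> descents \<pi> = {}}"
proof (rule bij_betw_same_card, rule bij_betw_byWitness)
  have len: "length \<pi> = n"
    using \<pi> by (simp add: permutations_of_set_def distinct_card[symmetric])
  have dist: "distinct \<pi>"
    using \<pi> by (simp add: permutations_of_set_def)
  let ?A = "{p. parking_function n p \<and> \<phi> p = \<pi>}"
  let ?B = "{w \<in> ballot_paths n n. north_rank w ` factors N N w \<inter> descents \<pi> = {}}"
  show "\<forall>p\<in>?A. attach_labels (map underlying_step p) \<pi> = p"
    by (auto simp: \<phi>_def attach_labels_underlying)
  show "\<forall>w\<in>?B. map underlying_step (attach_labels w \<pi>) = w"
    by (simp add: underlying_attach_labels)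
  show "map underlying_step ` ?A \<subseteq> ?B"
  proof (rule image_subsetI)
    fix p assume "p \<in> ?A"
    then have p: "parking_function n p" "north_labels p = \<pi>"
      by (simp_all add: \<phi>_def)
    then have "map underlying_step p \<in> ballot_paths n n"
      by (simp add: parking_function_def dyck_path_iff_ballot)
    then show "map underlying_step p \<in> ?B"
      using labels_increasing_iff_descents[of p] p dist by (simp add: parking_function_def)
  qed
  show "(\<lambda>w. attach_labels w \<pi>) ` ?B \<subseteq> ?A"
  proof safe
    fix w assume w: "w \<in> ballot_paths n n" "north_rank w ` factors N N w \<inter> descents \<pi> = {}"
    then have l: "north_labels (attach_labels w \<pi>) = \<pi>"
      by (intro north_labels_attach_labels) (simp add: ballot_paths_def len)
    then show "\<phi> (attach_labels w \<pi>) = \<pi>"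
      by (simp add: \<phi>_def)
    show "parking_function n (attach_labels w \<pi>)"
      using labels_increasing_iff_descents[of "attach_labels w \<pi>"] w l dist \<pi>
      by (simp add: parking_function_def dyck_path_iff_ballot underlying_attach_labels)
  qed
qed

text \<open>Parking functions are grouped by their label word. Each summand depends on
  \<open>\<pi>\<close> only through its descent set.\<close>

lemma pf_eq_sum:
  "pf n R = (\<Sum>\<pi> | \<pi> \<in> permutations_of_set {1..n} \<and> (\<forall>\<rho>\<in>R. perm_avoids \<pi> \<rho>).
     card {w \<in> ballot_paths n n. north_rank w ` factors N N w \<inter> descents \<pi> = {}})"
proof -
  let ?A = "{\<pi> \<in> permutations_of_set {1..n}. \<forall>\<rho>\<in>R. perm_avoids \<pi> \<rho>}"
  let ?P = "\<lambda>\<pi>. {p. parking_function n p \<and> \<phi> p = \<pi>}"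
  have "finite (?P \<pi>)" for \<pi>
  proof (rule finite_subset)
    show "?P \<pi> \<subseteq> (\<lambda>w. attach_labels w \<pi>) ` ballot_paths n n"
    proof
      fix p assume "p \<in> ?P \<pi>"
      then have "p = attach_labels (map underlying_step p) \<pi>" "map underlying_step p \<in> ballot_paths n n"
        by (auto simp: parking_function_def dyck_path_iff_ballot \<phi>_def attach_labels_underlying)
      then show "p \<in> (\<lambda>w. attach_labels w \<pi>) ` ballot_paths n n" by blast
    qed
  qed (simp add: finite_ballot_paths)
  moreover have "{p. parking_function n p \<and> (\<forall>\<rho>\<in>R. perm_avoids (\<phi> p) \<rho>)} = (\<Union>\<pi>\<in>?A. ?P \<pi>)"
    by (auto simp: parking_function_def \<phi>_def)
  moreover have "finite ?A"
    by simp
  ultimately have "pf n R = (\<Sum>\<pi>\<in>?A. card (?P \<pi>))"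
    unfolding pf_def by (simp only:) (rule card_UN_disjoint, auto)
  also have "\<dots> = (\<Sum>\<pi>\<in>?A. card {w \<in> ballot_paths n n. north_rank w ` factors N N w \<inter> descents \<pi> = {}})"
    by (rule sum.cong) (simp_all add: card_parking_functions_with_labels)
  finally show ?thesis .
qed

section \<open>Ranks of peaks and double rises in Dyck paths\<close>

lemma card_N_positions: "card {i. i < length w \<and> w ! i = N} = count_list w N"
  by (simp add: count_list_eq_length_filter length_filter_conv_card eq_commute[of N])

text \<open>Each of the \<open>n\<close> north steps is followed by either an east step or another
  north step.\<close>

lemma peaks_plus_double_rises:
  assumes "w \<in> ballot_paths n n"
  shows "card (factors N E w) + card (factors N N w) = n"
proof -
  \<comment> \<open>A path ending in \<open>N\<close> would, without that step, have
    \<open>n - 1\<close> north and \<open>n\<close> east steps, which lies below the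
    diagonal.\<close>
  have "Suc i < length w" if "i < length w" "w ! i = N" for i
  proof (rule ccontr)
    assume "\<not> Suc i < length w"
    then have "w = butlast w @ [N]"
      using that by (metis Suc_lessI append_butlast_last_id diff_Suc_1 last_conv_nth length_0_conv not_less_zero)
    then have "butlast w @ [N] \<in> ballot_paths n n"
      using assms by simp
    then show False
      by (auto simp: ballot_paths_snoc ballot_paths_empty)
  qed
  then have "{i. i < length w \<and> w ! i = N} = factors N E w \<union> factors N N w"
    by (auto simp: factors_def) (metis step.exhaust)
  moreover have "factors N E w \<inter> factors N N w = {}"
    by (auto simp: factors_def)
  ultimately have "card {i. i < length w \<and> w ! i = N} = card (factors N E w) + card (factors N N w)"
    by (simp add: card_Un_disjoint finite_factors)
  then show ?thesis
    using assms by (simp add: card_N_positions ballot_paths_def)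
qed

lemma north_rank_less:
  assumes "i < j" "j < length w" "w ! j = N"
  shows "north_rank w i < north_rank w j"
proof -
  have "take (Suc j) w = take (Suc i) w @ drop (Suc i) (take j w) @ [N]"
    using assms by (metis append.assoc append_take_drop_id min.absorb1 Suc_leI take_Suc_conv_app_nth take_take)
  then show ?thesis
    by (simp add: north_rank_def)
qed

text \<open>The double rises have distinct ranks below \<open>n\<close>, so \<open>n\<close> minus
  their number of values remain, which is the number of peaks.\<close>

lemma card_ranks_without_double_rise:
  assumes w: "w \<in> ballot_paths n n"
  shows "card {d. d < n \<and> d \<notin> north_rank w ` factors N N w} = card (factors N E w)"
proof -
  have "inj_on (north_rank w) (factors N N w)"
  proof (rule linorder_inj_onI)
    show "north_rank w i \<noteq> north_rank w j" if "i < j" "i \<in> factors N N w" "j \<in> factors N N w" for i j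
      using north_rank_less[of i j w] that by (simp add: factors_def)
  qed auto
  then have "card (north_rank w ` factors N N w) = card (factors N N w)"
    by (rule card_image)
  moreover have "north_rank w ` factors N N w \<subseteq> {..<n}"
  proof (rule image_subsetI)
    \<comment> \<open>The rank stays below \<open>n\<close> because a further north step
      follows.\<close>
    fix i assume "i \<in> factors N N w"
    then have i: "Suc i < length w" "w ! Suc i = N"
      by (simp_all add: factors_def)
    then have "north_rank w i < north_rank w (Suc i)"
      by (intro north_rank_less) auto
    also have "\<dots> \<le> count_list w N"
      unfolding north_rank_def by (metis append_take_drop_id count_list_append le_add1)
    finally show "north_rank w i \<in> {..<n}"
      using w by (simp add: ballot_paths_def)
  qed
  moreover have "{d. d < n \<and> d \<notin> north_rank w ` factors N N w} = {..<n} - north_rank w ` factors N N w"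
    by auto
  ultimately have "card {d. d < n \<and> d \<notin> north_rank w ` factors N N w} = n - card (factors N N w)"
    by (simp add: card_Diff_subset finite_factors)
  then show ?thesis
    using peaks_plus_double_rises[OF w] by linarith
qed

text \<open>The identity, \<open>f 0\<close>, stands for the last peak of a path, whose rank is always \<open>n\<close>; for
  \<open>d > 0\<close> the permutation \<open>f d\<close> counts the paths with a peak at the \<open>d\<close>-th north step.\<close>

lemma pf_single_descent_family:
  assumes "n \<ge> 1"
    and avoid: "{\<pi> \<in> permutations_of_set {1..n}. \<forall>\<rho>\<in>R. perm_avoids \<pi> \<rho>} = f ` {..<n}"
    and desc: "\<And>d. d < n \<Longrightarrow> descents (f d) = {d} - {0}"
  shows "pf n R = (2 * n - 1) choose n"
proof -
  let ?D = "\<lambda>w. north_rank w ` factors N N w"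
  \<comment> \<open>The rank of a north step counts that step itself, so it is at least 1.\<close>
  have pos: "0 \<notin> ?D w" for w
    by (auto simp: factors_def north_rank_def take_Suc_conv_app_nth)
  have "inj_on f {..<n}"
  proof (rule inj_onI)
    fix d e assume "d \<in> {..<n}" "e \<in> {..<n}" "f d = f e"
    then have "{d} - {0} = {e} - {0}"
      using desc by (metis lessThan_iff)
    then show "d = e" by (cases "d = 0"; cases "e = 0") auto
  qed
  then have "pf n R = (\<Sum>d<n. card {w \<in> ballot_paths n n. ?D w \<inter> descents (f d) = {}})"
    unfolding pf_eq_sum avoid by (simp add: sum.reindex)
  also have "\<dots> = (\<Sum>d<n. card {w \<in> ballot_paths n n. d \<notin> ?D w})"
  proof (intro sum.cong refl arg_cong[where f = card] Collect_cong conj_cong)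
    fix d w assume "d \<in> {..<n}"
    then show "?D w \<inter> descents (f d) = {} \<longleftrightarrow> d \<notin> ?D w"
      using desc pos[of w] by (cases "d = 0") auto
  qed
  \<comment> \<open>Double counting of the pairs \<open>(d, w)\<close> with \<open>d\<close> not the
    rank of a double rise of \<open>w\<close>.\<close>
  also have "\<dots> = (\<Sum>w\<in>ballot_paths n n. card {d \<in> {..<n}. d \<notin> ?D w})"
    by (rule sum_multicount_gen) (auto simp: finite_ballot_paths)
  also have "\<dots> = (\<Sum>w\<in>ballot_paths n n. card (factors N E w))"
    using card_ranks_without_double_rise by (intro sum.cong) auto
  also have "\<dots> = (2 * n - 1) choose n"
    using assms(1) by (rule sum_peaks_dyck)
  finally show ?thesis .
qed

section \<open>The three classes of permutations\<close>

text \<open>An embedding of the pattern is determined by three indices, and the three comparisons of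
  an entry with itself are trivial.\<close>

lemma perm_contains_triple:
  "perm_contains \<pi> [a, b, c] \<longleftrightarrow> (\<exists>i j k. i < j \<and> j < k \<and> k < length \<pi> \<and>
     (\<pi> ! i \<le> \<pi> ! j \<longleftrightarrow> a \<le> b) \<and> (\<pi> ! j \<le> \<pi> ! i \<longleftrightarrow> b \<le> a) \<and>
     (\<pi> ! i \<le> \<pi> ! k \<longleftrightarrow> a \<le> c) \<and> (\<pi> ! k \<le> \<pi> ! i \<longleftrightarrow> c \<le> a) \<and>
     (\<pi> ! j \<le> \<pi> ! k \<longleftrightarrow> b \<le> c) \<and> (\<pi> ! k \<le> \<pi> ! j \<longleftrightarrow> c \<le> b))"
  (is "?L \<longleftrightarrow> (\<exists>i j k. ?Q i j k)")
proof
  assume ?L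
  then obtain f :: "nat \<Rightarrow> nat" where f: "strict_mono_on {..<3} f" "\<forall>x<3. f x < length \<pi>"
    "\<forall>x<3. \<forall>y<3. \<pi> ! f x \<le> \<pi> ! f y \<longleftrightarrow> [a, b, c] ! x \<le> [a, b, c] ! y"
    by (auto simp: perm_contains_def numeral_3_eq_3)
  have "f 0 < f 1" "f 1 < f 2"
    using f(1) by (auto simp: strict_mono_on_def)
  then have "?Q (f 0) (f 1) (f 2)"
    using f(2,3) by (simp add: numeral_3_eq_3 numeral_2_eq_2 All_less_Suc)
  then show "\<exists>i j k. ?Q i j k" by blast
next
  assume "\<exists>i j k. ?Q i j k"
  then obtain i j k where "?Q i j k" by blast
  then show ?L
    unfolding perm_contains_def
    by (intro exI[of _ "\<lambda>x. [i, j, k] ! x"])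
      (auto simp: strict_mono_on_def All_less_Suc less_Suc_eq)
qed

lemma perm_contains_patterns:
  "perm_contains \<pi> [1,3,2] \<longleftrightarrow>
     (\<exists>i j k. i < j \<and> j < k \<and> k < length \<pi> \<and> \<pi> ! i < \<pi> ! k \<and> \<pi> ! k < \<pi> ! j)"
  "perm_contains \<pi> [2,1,3] \<longleftrightarrow>
     (\<exists>i j k. i < j \<and> j < k \<and> k < length \<pi> \<and> \<pi> ! j < \<pi> ! i \<and> \<pi> ! i < \<pi> ! k)"
  "perm_contains \<pi> [2,3,1] \<longleftrightarrow>
     (\<exists>i j k. i < j \<and> j < k \<and> k < length \<pi> \<and> \<pi> ! k < \<pi> ! i \<and> \<pi> ! i < \<pi> ! j)"
  "perm_contains \<pi> [3,1,2] \<longleftrightarrow>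
     (\<exists>i j k. i < j \<and> j < k \<and> k < length \<pi> \<and> \<pi> ! j < \<pi> ! k \<and> \<pi> ! k < \<pi> ! i)"
  "perm_contains \<pi> [3,2,1] \<longleftrightarrow>
     (\<exists>i j k. i < j \<and> j < k \<and> k < length \<pi> \<and> \<pi> ! k < \<pi> ! j \<and> \<pi> ! j < \<pi> ! i)"
  unfolding perm_contains_triple
  subgoal by (intro iff_exI) auto
  subgoal by (intro iff_exI) auto
  subgoal by (intro iff_exI) auto
  subgoal by (intro iff_exI) auto
  subgoal by (intro iff_exI) auto
  done

section \<open>Increasing lists and lists with at most one descent\<close>

lemma strict_sorted_eq_upt:
  fixes xs :: "nat list"
  assumes "sorted_wrt (<) xs" "set xs = {a..<b}"
  shows "xs = [a..<b]"
  using assms by (intro strict_sorted_equal) auto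

text \<open>\<open>P\<close> describes the only inversions permitted. It is applied after removing
  the entry, \<open>1\<close> or \<open>n\<close>, that every permitted inversion involves.\<close>

lemma strict_sorted_if_descents_excluded:
  fixes xs :: "nat list"
  assumes "sorted_wrt (\<lambda>x y. y < x \<longrightarrow> P x y) xs" "distinct xs"
    and "\<And>x y. x \<in> set xs \<Longrightarrow> y \<in> set xs \<Longrightarrow> \<not> P x y"
  shows "sorted_wrt (<) xs"
  using assms
proof (induction xs)
  case (Cons x xs)
  have "x < y" if "y \<in> set xs" for y
    using Cons.prems that by (metis distinct.simps(2) linorder_neqE_nat list.set_intros sorted_wrt.simps(2))
  moreover have "sorted_wrt (<) xs"
    using Cons by simp
  ultimately show ?case by simp
qed simp

lemma strict_sorted_descents_vacuous:
  fixes xs :: "nat list"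
  assumes "sorted_wrt (<) xs"
  shows "sorted_wrt (\<lambda>x y. y < x \<longrightarrow> P x y) xs"
  using assms by (rule sorted_wrt_mono_rel[rotated]) simp

text \<open>Inside each run there is no descent, so only the seam can be one. Subtracting
  \<open>{0}\<close> covers an empty \<open>xs\<close>, where there is no seam.\<close>

lemma descents_append:
  assumes "sorted_wrt (<) xs" "sorted_wrt (<) ys" "ys \<noteq> []" "xs \<noteq> [] \<Longrightarrow> hd ys < last xs"
  shows "descents (xs @ ys) = {length xs} - {0}"
proof -
  have "i \<in> descents (xs @ ys) \<longleftrightarrow> i = length xs \<and> i \<noteq> 0" for i
  proof -
    consider "i = 0" | "0 < i" "i < length xs" | "0 < i" "i = length xs" | "length xs < i" "i < length (xs @ ys)"
      | "i \<ge> length (xs @ ys)"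
      by force
    then show ?thesis
    proof cases
      case 2
      then have "xs ! (i - 1) < xs ! i"
        using assms(1) by (simp add: sorted_wrt_iff_nth_less)
      then show ?thesis using 2 by (auto simp: descents_def nth_append)
    next
      case 3
      then show ?thesis
        using assms(3,4) by (auto simp: descents_def nth_append hd_conv_nth last_conv_nth)
    next
      case 4
      then have "ys ! (i - 1 - length xs) < ys ! (i - length xs)"
        using assms(2) by (simp add: sorted_wrt_iff_nth_less)
      then show ?thesis using 4 by (auto simp: descents_def nth_append)
    qed (use assms(3) in \<open>auto simp: descents_def\<close>)
  qed
  then show ?thesis by auto
qed

section \<open>Avoidance expressed as a restriction on inversions\<close>

lemma perm_nth_bounds:
  assumes "\<pi> \<in> permutations_of_set {1..n}" "i < length \<pi>"
  shows "1 \<le> \<pi> ! i" "\<pi> ! i \<le> n"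
  using assms nth_mem[OF assms(2)] by (auto simp: permutations_of_set_def)

text \<open>The three patterns arise from the inversion \<open>32\<close> by placing
  \<open>1\<close> before, between or after its entries. Avoiding all of them therefore forces the
  lower entry of every inversion to be the minimum.\<close>

lemma avoids_132_312_321_iff:
  assumes \<pi>: "\<pi> \<in> permutations_of_set {1..n}"
  shows "(\<forall>\<rho>\<in>{[1,3,2], [3,1,2], [3,2,1]}. perm_avoids \<pi> \<rho>) \<longleftrightarrow>
    sorted_wrt (\<lambda>x y. y < x \<longrightarrow> y = 1) \<pi>"
proof (cases "n = 0")
  case True
  then show ?thesis
    using \<pi> by (auto simp: permutations_of_set_def perm_avoids_def perm_contains_triple)
next
  case False
  then obtain m where m: "m < length \<pi>" "\<pi> ! m = 1"
    using \<pi> by (metis (no_types, lifting) Suc_leI atLeastAtMost_iff in_set_conv_nth neq0_conv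
        One_nat_def le_refl permutations_of_setD(1))
  show ?thesis
  proof
    assume "\<forall>\<rho>\<in>{[1,3,2], [3,1,2], [3,2,1]}. perm_avoids \<pi> \<rho>"
    then have "\<not> perm_contains \<pi> [1,3,2]" "\<not> perm_contains \<pi> [3,1,2]" "\<not> perm_contains \<pi> [3,2,1]"
      by (simp_all add: perm_avoids_def)
    note av = this[unfolded perm_contains_patterns]
    show "sorted_wrt (\<lambda>x y. y < x \<longrightarrow> y = 1) \<pi>"
      unfolding sorted_wrt_iff_nth_less
    proof (intro allI impI, rule ccontr)
      fix i j assume ij: "i < j" "j < length \<pi>" "\<pi> ! j < \<pi> ! i" "\<pi> ! j \<noteq> 1"
      then have "\<pi> ! m < \<pi> ! j"
        using perm_nth_bounds(1)[OF \<pi>, of j] m by simp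
      moreover have "m \<noteq> i" "m \<noteq> j"
        using calculation ij by auto
      \<comment> \<open>The three positions of the value \<open>1\<close> yield 132, 312 and 321
        respectively.\<close>
      ultimately have "m < i \<or> i < m \<and> m < j \<or> j < m" "\<pi> ! m < \<pi> ! j"
        by auto
      then show False
        using av m ij by blast
    qed
  next
    assume sorted: "sorted_wrt (\<lambda>x y. y < x \<longrightarrow> y = 1) \<pi>"
    have desc: "\<pi> ! j = 1" if "i < j" "j < length \<pi>" "\<pi> ! j < \<pi> ! i" for i j
      using sorted that by (auto simp: sorted_wrt_iff_nth_less)
    have low: "1 \<le> \<pi> ! i" if "i < length \<pi>" for i
      using perm_nth_bounds[OF \<pi> that] by simp
    have "\<not> perm_contains \<pi> [1,3,2]"
      unfolding perm_contains_patterns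
    proof clarify
      fix i j k assume "i < j" "j < k" "k < length \<pi>" "\<pi> ! i < \<pi> ! k" "\<pi> ! k < \<pi> ! j"
      then show False
        using desc[of j k] low[of i] by auto
    qed
    moreover have "\<not> perm_contains \<pi> [3,1,2]"
      unfolding perm_contains_patterns
    proof clarify
      fix i j k assume "i < j" "j < k" "k < length \<pi>" "\<pi> ! j < \<pi> ! k" "\<pi> ! k < \<pi> ! i"
      then show False
        using desc[of i k] low[of j] by auto
    qed
    moreover have "\<not> perm_contains \<pi> [3,2,1]"
      unfolding perm_contains_patterns
    proof clarify
      fix i j k assume "i < j" "j < k" "k < length \<pi>" "\<pi> ! k < \<pi> ! j" "\<pi> ! j < \<pi> ! i"
      then show False
        using desc[of i j] low[of k] by auto
    qed
    ultimately show "\<forall>\<rho>\<in>{[1,3,2], [3,1,2], [3,2,1]}. perm_avoids \<pi> \<rho>"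
      by (simp add: perm_avoids_def)
  qed
qed

text \<open>Here the patterns arise from the inversion \<open>21\<close> by placing \<open>3\<close>
  after, between or before its entries, so the larger entry of every inversion must be the
  maximum.\<close>

lemma avoids_213_231_321_iff:
  assumes \<pi>: "\<pi> \<in> permutations_of_set {1..n}"
  shows "(\<forall>\<rho>\<in>{[2,1,3], [2,3,1], [3,2,1]}. perm_avoids \<pi> \<rho>) \<longleftrightarrow>
    sorted_wrt (\<lambda>x y. y < x \<longrightarrow> x = n) \<pi>"
proof (cases "n = 0")
  case True
  then show ?thesis
    using \<pi> by (auto simp: permutations_of_set_def perm_avoids_def perm_contains_triple)
next
  case False
  then obtain m where m: "m < length \<pi>" "\<pi> ! m = n"
    using \<pi> by (metis (no_types, lifting) Suc_leI atLeastAtMost_iff in_set_conv_nth neq0_conv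
        One_nat_def le_refl permutations_of_setD(1))
  show ?thesis
  proof
    assume "\<forall>\<rho>\<in>{[2,1,3], [2,3,1], [3,2,1]}. perm_avoids \<pi> \<rho>"
    then have "\<not> perm_contains \<pi> [2,1,3]" "\<not> perm_contains \<pi> [2,3,1]" "\<not> perm_contains \<pi> [3,2,1]"
      by (simp_all add: perm_avoids_def)
    note av = this[unfolded perm_contains_patterns]
    show "sorted_wrt (\<lambda>x y. y < x \<longrightarrow> x = n) \<pi>"
      unfolding sorted_wrt_iff_nth_less
    proof (intro allI impI, rule ccontr)
      fix i j assume ij: "i < j" "j < length \<pi>" "\<pi> ! j < \<pi> ! i" "\<pi> ! i \<noteq> n"
      then have "\<pi> ! i < \<pi> ! m"
        using perm_nth_bounds(2)[OF \<pi>, of i] m by simp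
      moreover have "m \<noteq> i" "m \<noteq> j"
        using calculation ij by auto
      \<comment> \<open>The three positions of the value \<open>n\<close> yield 321, 231 and 213
        respectively.\<close>
      ultimately have "m < i \<or> i < m \<and> m < j \<or> j < m" "\<pi> ! i < \<pi> ! m"
        by auto
      then show False
        using av m ij by blast
    qed
  next
    assume sorted: "sorted_wrt (\<lambda>x y. y < x \<longrightarrow> x = n) \<pi>"
    have desc: "\<pi> ! i = n" if "i < j" "j < length \<pi>" "\<pi> ! j < \<pi> ! i" for i j
      using sorted that by (auto simp: sorted_wrt_iff_nth_less)
    have high: "\<pi> ! i \<le> n" if "i < length \<pi>" for i
      using perm_nth_bounds[OF \<pi> that] by simp
    have "\<not> perm_contains \<pi> [2,1,3]"
      unfolding perm_contains_patterns
    proof clarify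
      fix i j k assume "i < j" "j < k" "k < length \<pi>" "\<pi> ! j < \<pi> ! i" "\<pi> ! i < \<pi> ! k"
      then show False
        using desc[of i j] high[of k] by auto
    qed
    moreover have "\<not> perm_contains \<pi> [2,3,1]"
      unfolding perm_contains_patterns
    proof clarify
      fix i j k assume "i < j" "j < k" "k < length \<pi>" "\<pi> ! k < \<pi> ! i" "\<pi> ! i < \<pi> ! j"
      then show False
        using desc[of i k] high[of j] by auto
    qed
    moreover have "\<not> perm_contains \<pi> [3,2,1]"
      unfolding perm_contains_patterns
    proof clarify
      fix i j k assume "i < j" "j < k" "k < length \<pi>" "\<pi> ! k < \<pi> ! j" "\<pi> ! j < \<pi> ! i"
      then show False
        using desc[of j k] high[of i] by auto
    qed
    ultimately show "\<forall>\<rho>\<in>{[2,1,3], [2,3,1], [3,2,1]}. perm_avoids \<pi> \<rho>"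
      by (simp add: perm_avoids_def)
  qed
qed

section \<open>Listing the three classes by descent position\<close>

text \<open>Every inversion involves \<open>1\<close>, so the class consists of the increasing list
  of \<open>2, ..., n\<close> with \<open>1\<close> inserted anywhere.\<close>

lemma pf_132_312_321:
  assumes "n \<ge> 1"
  shows "pf n {[1,3,2], [3,1,2], [3,2,1]} = (2 * n - 1) choose n"
proof (rule pf_single_descent_family[OF assms])
  \<comment> \<open>Keeps \<open>take\<close> and \<open>drop\<close> of the interval symbolic, so
    that facts about the split list still apply.\<close>
  note [simp del] = upt_Suc drop_upt take_upt
  let ?L = "[2..<Suc n]"
  \<comment> \<open>The value \<open>1\<close> lands at index \<open>d\<close>, which is the descent
    unless \<open>d = 0\<close>.\<close>
  let ?f = "\<lambda>d. take d ?L @ 1 # drop d ?L"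
  have split: "set (take d ?L) \<union> set (drop d ?L) = {2..n}"
    "sorted_wrt (<) (take d ?L @ drop d ?L)" "distinct (take d ?L @ drop d ?L)" for d
    by (simp_all flip: set_append add: atLeastLessThanSuc_atLeastAtMost)
  show "descents (?f d) = {d} - {0}" if "d < n" for d
  proof -
    have "length (take d ?L) = d"
      using that by simp
    moreover have elems: "set (take d ?L) \<subseteq> {2..n}" "set (drop d ?L) \<subseteq> {2..n}"
      using split(1)[of d] by blast+
    have "1 < last (take d ?L)" if "take d ?L \<noteq> []"
      using subsetD[OF elems(1) last_in_set[OF that]] by simp
    moreover have "\<forall>x\<in>set (drop d ?L). 1 < x"
      using elems(2) by auto
    ultimately show ?thesis
      using split(2)[of d] descents_append[of "take d ?L" "1 # drop d ?L"]
      by (simp add: sorted_wrt_append del: append_take_drop_id)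
  qed
  show "{\<pi> \<in> permutations_of_set {1..n}. \<forall>\<rho>\<in>{[1,3,2], [3,1,2], [3,2,1]}. perm_avoids \<pi> \<rho>} = ?f ` {..<n}"
    (is "?A = _")
  proof (intro equalityI subsetI)
    fix \<pi> assume "\<pi> \<in> ?A"
    then have \<pi>: "set \<pi> = {1..n}" "distinct \<pi>" and sorted: "sorted_wrt (\<lambda>x y. y < x \<longrightarrow> y = 1) \<pi>"
      using avoids_132_312_321_iff[of \<pi> n] by (auto simp: permutations_of_set_def)
    obtain xs ys where eq: "\<pi> = xs @ 1 # ys"
      using \<pi> assms by (metis atLeastAtMost_iff order_refl split_list)
    \<comment> \<open>Without the entry \<open>1\<close> no inversion is permitted, so the remaining
      entries are in increasing order.\<close>
    have "sorted_wrt (\<lambda>x y. y < x \<longrightarrow> y = 1) (xs @ ys)"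
      using sorted by (auto simp: eq sorted_wrt_append)
    then have "sorted_wrt (<) (xs @ ys)"
      by (rule strict_sorted_if_descents_excluded) (use \<pi>(2) in \<open>auto simp: eq\<close>)
    moreover have "set (xs @ ys) = set \<pi> - {1}"
      using \<pi>(2) by (auto simp: eq)
    moreover have "set \<pi> - {1} = {2..<Suc n}"
      unfolding \<pi>(1) by auto
    ultimately have L: "xs @ ys = ?L"
      by (intro strict_sorted_eq_upt) simp_all
    have "length (xs @ ys) = n - 1"
      unfolding L by simp
    moreover have "\<pi> = ?f (length xs)"
      unfolding L[symmetric] by (simp add: eq)
    ultimately show "\<pi> \<in> ?f ` {..<n}"
      using assms by (intro image_eqI[of _ _ "length xs"]) auto
  next
    fix \<pi> assume "\<pi> \<in> ?f ` {..<n}"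
    then obtain d where \<pi>: "\<pi> = ?f d"
      by blast
    have elems: "set (take d ?L) \<subseteq> {2..n}" "set (drop d ?L) \<subseteq> {2..n}"
      using split(1)[of d] by blast+
    have "set \<pi> = insert 1 (set (take d ?L) \<union> set (drop d ?L))"
      by (simp add: \<pi>)
    also have "\<dots> = insert 1 {2..n}"
      by (simp only: split(1))
    also have "\<dots> = {1..n}"
      using assms by auto
    finally have "set \<pi> = {1..n}" .
    moreover have "1 \<notin> set (take d ?L)" "1 \<notin> set (drop d ?L)"
      using subsetD[OF elems(1), of 1] subsetD[OF elems(2), of 1] by auto
    then have "distinct \<pi>"
      using split(3)[of d, unfolded distinct_append] by (simp add: \<pi>)
    ultimately have perm: "\<pi> \<in> permutations_of_set {1..n}"
      by (rule permutations_of_setI)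
    have less: "\<forall>x\<in>set (drop d ?L). 1 < x"
      using elems(2) by auto
    have "\<forall>x\<in>set (take d ?L). \<forall>y\<in>set (drop d ?L). \<not> y < x"
      "sorted_wrt (<) (take d ?L)" "sorted_wrt (<) (drop d ?L)"
      using split(2)[of d, unfolded sorted_wrt_append] by (meson less_asym)+
    then have "sorted_wrt (\<lambda>x y. y < x \<longrightarrow> y = 1) \<pi>"
      using less unfolding \<pi> sorted_wrt_append
      by (simp add: strict_sorted_descents_vacuous) (meson Suc_lessD)
    then show "\<pi> \<in> ?A"
      using perm avoids_132_312_321_iff[OF perm] by simp
  qed
qed

text \<open>Every inversion involves \<open>n\<close>, so the class consists of the increasing list
  of \<open>1, ..., n - 1\<close> with \<open>n\<close> inserted anywhere.\<close>

lemma pf_213_231_321: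
  assumes "n \<ge> 1"
  shows "pf n {[2,1,3], [2,3,1], [3,2,1]} = (2 * n - 1) choose n"
proof (rule pf_single_descent_family[OF assms])
  note [simp del] = upt_Suc drop_upt take_upt
  let ?L = "[1..<n]"
  let ?g = "\<lambda>e. take e ?L @ n # drop e ?L"
  \<comment> \<open>With \<open>n\<close> at index \<open>e\<close> the descent comes one place
    later, at \<open>e + 1\<close>, except that \<open>e = n - 1\<close> gives the identity; hence
    the shift and the separate value at 0.\<close>
  let ?f = "\<lambda>d. if d = 0 then ?g (n - 1) else ?g (d - 1)"
  have split: "set (take d ?L) \<union> set (drop d ?L) = {1..<n}"
    "sorted_wrt (<) (take d ?L @ drop d ?L)" "distinct (take d ?L @ drop d ?L)" for d
    by (simp_all flip: set_append)
  have asc: "sorted_wrt (<) (take e ?L @ [n])" for e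
    using split(1,2)[of e] by (auto simp: sorted_wrt_append simp del: append_take_drop_id)
  show "descents (?f d) = {d} - {0}" if "d < n" for d
  proof (cases "d = 0")
    case True
    then show ?thesis
      using descents_append[of "[]" "?g (n - 1)"] asc[of "n - 1"] by simp
  next
    case False
    have "drop (d - 1) ?L \<noteq> []"
      using that False by simp
    moreover from this have "hd (drop (d - 1) ?L) < n"
      using split(1)[of "d - 1"] hd_in_set by fastforce
    moreover have "length (take (d - 1) ?L @ [n]) = d"
      using that False by simp
    ultimately show ?thesis
      using False asc[of "d - 1"] split(2)[of "d - 1"]
        descents_append[of "take (d - 1) ?L @ [n]" "drop (d - 1) ?L"]
      by (simp add: sorted_wrt_append del: append_take_drop_id)
  qed
  show "{\<pi> \<in> permutations_of_set {1..n}. \<forall>\<rho>\<in>{[2,1,3], [2,3,1], [3,2,1]}. perm_avoids \<pi> \<rho>} = ?f ` {..<n}"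
    (is "?A = _")
  proof (intro equalityI subsetI)
    fix \<pi> assume "\<pi> \<in> ?A"
    then have \<pi>: "set \<pi> = {1..n}" "distinct \<pi>" and sorted: "sorted_wrt (\<lambda>x y. y < x \<longrightarrow> x = n) \<pi>"
      using avoids_213_231_321_iff[of \<pi> n] by (auto simp: permutations_of_set_def)
    obtain xs ys where eq: "\<pi> = xs @ n # ys"
      using \<pi> assms by (metis atLeastAtMost_iff order_refl split_list)
    have "sorted_wrt (\<lambda>x y. y < x \<longrightarrow> x = n) (xs @ ys)"
      using sorted by (auto simp: eq sorted_wrt_append)
    then have "sorted_wrt (<) (xs @ ys)"
      by (rule strict_sorted_if_descents_excluded) (use \<pi>(2) in \<open>auto simp: eq\<close>)
    moreover have "set (xs @ ys) = set \<pi> - {n}"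
      using \<pi>(2) by (auto simp: eq)
    moreover have "set \<pi> - {n} = {1..<n}"
      unfolding \<pi>(1) by auto
    ultimately have L: "xs @ ys = ?L"
      by (intro strict_sorted_eq_upt) simp_all
    have len: "length (xs @ ys) = n - 1"
      unfolding L by simp
    have "\<pi> = ?g (length xs)"
      unfolding L[symmetric] by (simp add: eq)
    then have "\<pi> = ?f (if length xs = n - 1 then 0 else Suc (length xs))"
      by simp
    then show "\<pi> \<in> ?f ` {..<n}"
      by (rule image_eqI) (use assms len in auto)
  next
    fix \<pi> assume "\<pi> \<in> ?f ` {..<n}"
    then obtain c where c: "\<pi> = ?f c"
      by blast
    \<comment> \<open>Translates the descent index \<open>c\<close> back into the insertion index of
      \<open>n\<close>.\<close>
    define d where "d = (if c = 0 then n - 1 else c - 1)"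
    have \<pi>: "\<pi> = ?g d"
      using c unfolding d_def by (cases "c = 0") simp_all
    have elems: "set (take d ?L) \<subseteq> {1..<n}" "set (drop d ?L) \<subseteq> {1..<n}"
      using split(1)[of d] by blast+
    have "set \<pi> = insert n (set (take d ?L) \<union> set (drop d ?L))"
      by (simp add: \<pi>)
    also have "\<dots> = insert n {1..<n}"
      by (simp only: split(1))
    also have "\<dots> = {1..n}"
      using assms by auto
    finally have "set \<pi> = {1..n}" .
    moreover have "n \<notin> set (take d ?L)" "n \<notin> set (drop d ?L)"
      using subsetD[OF elems(1), of n] subsetD[OF elems(2), of n] by auto
    then have "distinct \<pi>"
      using split(3)[of d, unfolded distinct_append] by (simp add: \<pi>)
    ultimately have perm: "\<pi> \<in> permutations_of_set {1..n}"
      by (rule permutations_of_setI)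
    have less: "\<forall>x\<in>set (take d ?L). x < n"
      using elems(1) by auto
    have "\<forall>x\<in>set (take d ?L). \<forall>y\<in>set (drop d ?L). \<not> y < x"
      "sorted_wrt (<) (take d ?L)" "sorted_wrt (<) (drop d ?L)"
      using split(2)[of d, unfolded sorted_wrt_append] by (meson less_asym)+
    then have "sorted_wrt (\<lambda>x y. y < x \<longrightarrow> x = n) \<pi>"
      using less unfolding \<pi> sorted_wrt_append
      by (simp add: strict_sorted_descents_vacuous) (meson less_asym)
    then show "\<pi> \<in> ?A"
      using perm avoids_213_231_321_iff[OF perm] by simp
  qed
qed

text \<open>The class consists of the rotations of the identity. Seen from the entry
  \<open>1\<close>, avoiding 132 makes the entries after it increase, avoiding 321 those before it,
  and avoiding 213 puts all earlier entries above all later ones.\<close>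

lemma pf_132_213_321:
  assumes "n \<ge> 1"
  shows "pf n {[1,3,2], [2,1,3], [3,2,1]} = (2 * n - 1) choose n"
proof (rule pf_single_descent_family[OF assms])
  note [simp del] = upt_Suc drop_upt take_upt
  let ?L = "[1..<Suc n]"
  \<comment> \<open>The \<open>d\<close> largest values move to the front, so \<open>1\<close>
    stands at index \<open>d\<close>.\<close>
  let ?f = "\<lambda>d. drop (n - d) ?L @ take (n - d) ?L"
  have split: "set (take d ?L) \<union> set (drop d ?L) = {1..n}"
    "sorted_wrt (<) (take d ?L @ drop d ?L)" "distinct (take d ?L @ drop d ?L)" for d
    by (simp_all flip: set_append add: atLeastLessThanSuc_atLeastAtMost)
  show "descents (?f d) = {d} - {0}" if "d < n" for d
  proof -
    have len: "length (drop (n - d) ?L) = d" and ne: "take (n - d) ?L \<noteq> []"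
      using that by simp_all
    have "hd (take (n - d) ?L) < last (drop (n - d) ?L)" if "drop (n - d) ?L \<noteq> []"
      using split(2)[of "n - d"] last_in_set[OF that] hd_in_set[OF ne]
      by (simp add: sorted_wrt_append del: append_take_drop_id)
    then show ?thesis
      using split(2)[of "n - d"] len ne descents_append[of "drop (n - d) ?L" "take (n - d) ?L"]
      by (simp add: sorted_wrt_append del: append_take_drop_id)
  qed
  show "{\<pi> \<in> permutations_of_set {1..n}. \<forall>\<rho>\<in>{[1,3,2], [2,1,3], [3,2,1]}. perm_avoids \<pi> \<rho>} = ?f ` {..<n}"
    (is "?A = _")
  proof (intro equalityI subsetI)
    fix \<pi> assume "\<pi> \<in> ?A"
    then have perm: "\<pi> \<in> permutations_of_set {1..n}"
      and av: "\<And>\<rho>. \<rho> \<in> {[1,3,2], [2,1,3], [3,2,1]} \<Longrightarrow> \<not> perm_contains \<pi> \<rho>"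
      by (auto simp: perm_avoids_def)
    then have \<pi>: "set \<pi> = {1..n}" "distinct \<pi>" "length \<pi> = n"
      by (auto simp: permutations_of_set_def distinct_card[symmetric])
    have "1 \<in> set \<pi>"
      using \<pi> assms by simp
    then obtain m where m: "m < n" "\<pi> ! m = 1"
      using \<pi>(3) by (auto simp: in_set_conv_nth)
    have above: "1 < \<pi> ! i" if "i < n" "i \<noteq> m" for i
      using perm_nth_bounds(1)[OF perm, of i] m that \<pi>(2,3)
      by (metis le_neq_implies_less nth_eq_iff_index_eq)
    have neq: "\<pi> ! i \<noteq> \<pi> ! j" if "i < j" "j < n" for i j
      using \<pi>(2,3) that by (simp add: nth_eq_iff_index_eq)
    \<comment> \<open>An inversion after \<open>m\<close> would form 132 with the entry
      \<open>1\<close> in front.\<close>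
    have after: "\<pi> ! i < \<pi> ! j" if "m \<le> i" "i < j" "j < n" for i j
    proof (rule ccontr)
      assume "\<not> \<pi> ! i < \<pi> ! j"
      then have "\<pi> ! j < \<pi> ! i" "i \<noteq> m"
        using neq[of i j] above[of j] m that by auto
      then have "perm_contains \<pi> [1,3,2]"
        using above[of j] m that \<pi>(3) unfolding perm_contains_patterns
        by (intro exI[of _ m] exI[of _ i] exI[of _ j]) auto
      then show False using av by simp
    qed
    \<comment> \<open>An inversion before \<open>m\<close> would form 321 with the entry
      \<open>1\<close> at the end.\<close>
    have before: "\<pi> ! i < \<pi> ! j" if "i < j" "j < m" for i j
    proof (rule ccontr)
      assume "\<not> \<pi> ! i < \<pi> ! j"
      then have "\<pi> ! j < \<pi> ! i"
        using neq[of i j] m that by auto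
      then have "perm_contains \<pi> [3,2,1]"
        using above[of j] m that \<pi>(3) unfolding perm_contains_patterns
        by (intro exI[of _ i] exI[of _ j] exI[of _ m]) auto
      then show False using av by simp
    qed
    \<comment> \<open>A rise across \<open>m\<close> would form 213 with the entry \<open>1\<close>
      in the middle.\<close>
    have across: "\<pi> ! j < \<pi> ! i" if "i < m" "m \<le> j" "j < n" for i j
    proof (rule ccontr)
      assume "\<not> \<pi> ! j < \<pi> ! i"
      then have "\<pi> ! i < \<pi> ! j" "j \<noteq> m"
        using neq[of i j] above[of i] m that by auto
      then have "perm_contains \<pi> [2,1,3]"
        using above[of i] m that \<pi>(3) unfolding perm_contains_patterns
        by (intro exI[of _ i] exI[of _ m] exI[of _ j]) auto
      then show False using av by simp
    qed
    \<comment> \<open>Rotating \<open>\<pi>\<close> so that \<open>1\<close> comes first gives an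
      increasing list, hence the identity.\<close>
    have "sorted_wrt (<) (drop m \<pi> @ take m \<pi>)"
      unfolding sorted_wrt_append
    proof (intro conjI ballI)
      show "sorted_wrt (<) (drop m \<pi>)" "sorted_wrt (<) (take m \<pi>)"
        using after before \<pi>(3) m by (auto simp: sorted_wrt_iff_nth_less)
      fix x y assume "x \<in> set (drop m \<pi>)" "y \<in> set (take m \<pi>)"
      then obtain i j where "x = \<pi> ! (m + i)" "m + i < n" "y = \<pi> ! j" "j < m"
        using \<pi>(3) m by (auto simp: in_set_conv_nth)
      then show "x < y"
        using across by simp
    qed
    moreover have "set (drop m \<pi> @ take m \<pi>) = {1..<Suc n}"
      unfolding set_append Un_commute[of "set (drop m \<pi>)"]
      by (simp add: \<pi>(1) atLeastLessThanSuc_atLeastAtMost flip: set_append)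
    ultimately have L: "drop m \<pi> @ take m \<pi> = ?L"
      by (rule strict_sorted_eq_upt)
    have "\<pi> = ?f m"
      unfolding L[symmetric] using \<pi>(3) m by simp
    then show "\<pi> \<in> ?f ` {..<n}"
      using m by blast
  next
    fix \<pi> assume "\<pi> \<in> ?f ` {..<n}"
    then obtain d where d: "d < n" and \<pi>: "\<pi> = ?f d"
      by blast
    have len: "length \<pi> = n" "length (drop (n - d) ?L) = d"
      using d by (simp_all add: \<pi>)
    have "set \<pi> = {1..n}"
      unfolding \<pi> set_append using split(1) by blast
    moreover have "distinct \<pi>"
      using split(3)[of "n - d"] by (auto simp: \<pi> simp del: append_take_drop_id)
    ultimately have perm: "\<pi> \<in> permutations_of_set {1..n}"
      by (rule permutations_of_setI)
    \<comment> \<open>Inversions are exactly the pairs with \<open>i < d \<le> j\<close>. In 132 and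
      213 this would make the outer pair an inversion too, and in 321 the middle index would lie on
      both sides of \<open>d\<close>.\<close>
    have order: "\<pi> ! i < \<pi> ! j \<longleftrightarrow> j < d \<or> d \<le> i" if "i < j" "j < n" for i j
    proof -
      have sorted: "sorted_wrt (<) (take (n - d) ?L)" "sorted_wrt (<) (drop (n - d) ?L)"
        "\<And>x y. x \<in> set (take (n - d) ?L) \<Longrightarrow> y \<in> set (drop (n - d) ?L) \<Longrightarrow> x < y"
        using split(2)[of "n - d"] unfolding sorted_wrt_append by blast+
      consider "j < d" | "i < d" "d \<le> j" | "d \<le> i"
        by linarith
      then show ?thesis
      proof cases
        case 1
        then have "drop (n - d) ?L ! i < drop (n - d) ?L ! j"
          using sorted(2) that len by (simp add: sorted_wrt_iff_nth_less)
        then show ?thesis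
          using 1 that len by (simp add: \<pi> nth_append del: nth_drop)
      next
        case 2
        have "length (take (n - d) ?L) = n - d"
          by simp
        then have "take (n - d) ?L ! (j - d) < drop (n - d) ?L ! i"
          using 2 that len(2) d by (intro sorted(3)[OF nth_mem nth_mem]) simp_all
        then show ?thesis
          using 2 that len by (simp add: \<pi> nth_append del: nth_drop nth_take)
      next
        case 3
        have "length (take (n - d) ?L) = n - d"
          by simp
        then have "take (n - d) ?L ! (i - d) < take (n - d) ?L ! (j - d)"
          using 3 sorted(1) that by (simp add: sorted_wrt_iff_nth_less del: nth_take)
        then show ?thesis
          using 3 that len by (simp add: \<pi> nth_append del: nth_drop nth_take)
      qed
    qed
    have "\<not> perm_contains \<pi> [1,3,2]"
      unfolding perm_contains_patterns len
    proof clarify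
      fix i j k assume "i < j" "j < k" "k < n" "\<pi> ! i < \<pi> ! k" "\<pi> ! k < \<pi> ! j"
      then show False
        using order[of i j] order[of j k] order[of i k] by auto
    qed
    moreover have "\<not> perm_contains \<pi> [2,1,3]"
      unfolding perm_contains_patterns len
    proof clarify
      fix i j k assume "i < j" "j < k" "k < n" "\<pi> ! j < \<pi> ! i" "\<pi> ! i < \<pi> ! k"
      then show False
        using order[of i j] order[of j k] order[of i k] by auto
    qed
    moreover have "\<not> perm_contains \<pi> [3,2,1]"
      unfolding perm_contains_patterns len
    proof clarify
      fix i j k assume "i < j" "j < k" "k < n" "\<pi> ! k < \<pi> ! j" "\<pi> ! j < \<pi> ! i"
      then show False
        using order[of i j] order[of j k] order[of i k] by auto
    qed
    ultimately show "\<pi> \<in> ?A"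
      using perm by (simp add: perm_avoids_def)
  qed
qed

theorem theorem15:
  fixes n :: nat
  assumes "n \<ge> 1"
  shows "pf n {[1,3,2], [2,1,3], [3,2,1]} = pf n {[1,3,2], [3,1,2], [3,2,1]} \<and>
         pf n {[1,3,2], [3,1,2], [3,2,1]} = pf n {[2,1,3], [2,3,1], [3,2,1]} \<and>
         pf n {[2,1,3], [2,3,1], [3,2,1]} = (2 * n - 1) choose n"
  using assms by (simp only: pf_132_213_321 pf_132_312_321 pf_213_231_321)

end
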